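(* Let $(X,d,E)$ be an $E$-bounded vector metric space and let $F$ be a Dedekind complete Riesz space. Let $C_v^o(X,F)$ be the set of all vectorial continuous functions $f:X\to F$ for which there is a positive operator $T:E\to F$ satisfying $|f(x)-f(y)|\le T(d(x,y))$ for all $x,y\in X$. Then $C_v^o(X,F)$ is a vector metric space when equipped with the $F$-valued uniform vector metric defined by $d_\infty(f,g)=\sup_{x\in X}|f(x)-g(x)|$.
   Context: In a Riesz space $E$, $a_n\downarrow 0$ means $(a_n)$ is a decreasing sequence in $E$ with $\inf_n a_n=0$. A Riesz space is Dedekind complete if every nonempty bounded above subset has a supremum. A (linear) operator $T:E\to F$ between Riesz spaces is positive if $T(x)\ge 0$ for all $x\ge 0$. A vector metric ($E$-metric) on a non-empty set $X$, with $E$ a Riesz space, is a map $d:X\times X\to E$ such that (vm1) $d(x,y)=0$ if and only if $x=y$; (vm2) $d(x,y)\le d(x,z)+d(y,z)$ for all $x,y,z\in X$. The triple $(X,d,E)$ is a vector metric space. A subset $A\subseteq X$ is $E$-bounded if there exists an element $a>0$ in $E$ such that $d(x,y)\le a$ for all $x,y\in A$; the space $X$ is $E$-bounded if this holds for $A=X$. A Riesz space $F$ is regarded as a vector metric space with the absolute valued vector metric $(u,v)\mapsto|u-v|\in F$. A sequence $(x_n)$ in $X$ is $E$-convergent to $x\in X$, written $x_n\xrightarrow{d,E}x$, if there is a sequence $(a_n)$ in $E$ with $a_n\downarrow 0$ and $d(x_n,x)\le a_n$ for all $n$. A function $f:(X,d,E)\to(Y,\rho,F)$ is vectorial continuous if,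 for every $x\in X$, $x_n\xrightarrow{d,E}x$ implies $f(x_n)\xrightarrow{\rho,F}f(x)$. *)

theory Defs
  imports Complex_Main "HOL-Library.Lattice_Algebras" "HOL-Library.Lub_Glb" "HOL-Library.FuncSet"
begin

class riesz_space = ordered_real_vector + lattice_ab_group_add_abs

text \<open>
  The operator \<open>Sup\<close> yields suprema of nonempty sets that are bounded above; on
  other sets its value is unspecified.
\<close>

class dedekind_complete_riesz_space = riesz_space + conditionally_complete_lattice

definition decreases_to_zero :: "(nat \<Rightarrow> 'e::riesz_space) \<Rightarrow> bool" where
  "decreases_to_zero a \<longleftrightarrow> decseq a \<and> isGlb UNIV (range a) 0"

definition positive_operator :: "('e::riesz_space \<Rightarrow> 'f::riesz_space) \<Rightarrow> bool" where
  "positive_operator T \<longleftrightarrow> linear T \<and> (\<forall>x\<ge>0. T x \<ge> 0)"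

text \<open>
  The triangle inequality is stated with both right-hand distances taken to the
  same point \<open>z\<close>, so that symmetry and nonnegativity are consequences.
\<close>

locale vector_metric_space =
  fixes X :: "'x set" and d :: "'x \<Rightarrow> 'x \<Rightarrow> 'e::riesz_space"
  assumes nonempty: "X \<noteq> {}"
    and vm1: "\<lbrakk>x \<in> X; y \<in> X\<rbrakk> \<Longrightarrow> d x y = 0 \<longleftrightarrow> x = y"
    and vm2: "\<lbrakk>x \<in> X; y \<in> X; z \<in> X\<rbrakk> \<Longrightarrow> d x y \<le> d x z + d y z"

definition E_bounded :: "('x \<Rightarrow> 'x \<Rightarrow> 'e::riesz_space) \<Rightarrow> 'x set \<Rightarrow> bool" where
  "E_bounded d A \<longleftrightarrow> (\<exists>a>0. \<forall>x\<in>A. \<forall>y\<in>A. d x y \<le> a)"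

definition E_converges :: "('x \<Rightarrow> 'x \<Rightarrow> 'e::riesz_space) \<Rightarrow> (nat \<Rightarrow> 'x) \<Rightarrow> 'x \<Rightarrow> bool" where
  "E_converges d xs x \<longleftrightarrow> (\<exists>a. decreases_to_zero a \<and> (\<forall>n. d (xs n) x \<le> a n))"

definition vectorial_continuous ::
    "'x set \<Rightarrow> ('x \<Rightarrow> 'x \<Rightarrow> 'e::riesz_space) \<Rightarrow>
     'y set \<Rightarrow> ('y \<Rightarrow> 'y \<Rightarrow> 'f::riesz_space) \<Rightarrow> ('x \<Rightarrow> 'y) \<Rightarrow> bool" where
  "vectorial_continuous X d Y \<rho> f \<longleftrightarrow> f \<in> X \<rightarrow> Y \<and>
     (\<forall>x\<in>X. \<forall>xs. range xs \<subseteq> X \<longrightarrow> E_converges d xs x \<longrightarrow> E_converges \<rho> (\<lambda>n. f (xs n)) (f x))"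

definition abs_metric :: "'f \<Rightarrow> 'f \<Rightarrow> 'f::riesz_space" where
  "abs_metric u v = \<bar>u - v\<bar>"

text \<open>
  A function on the carrier \<open>X\<close> is represented by its extensional version, which is
  \<open>undefined\<close> outside \<open>X\<close>; two such functions are equal iff they agree on \<open>X\<close>.
\<close>

definition C_vo :: "'x set \<Rightarrow> ('x \<Rightarrow> 'x \<Rightarrow> 'e::riesz_space) \<Rightarrow> ('x \<Rightarrow> 'f::riesz_space) set" where
  "C_vo X d = {f \<in> extensional X. vectorial_continuous X d UNIV abs_metric f \<and>
     (\<exists>T. positive_operator T \<and> (\<forall>x\<in>X. \<forall>y\<in>X. \<bar>f x - f y\<bar> \<le> T (d x y)))}"

definition uniform_metric ::
    "'x set \<Rightarrow> ('x \<Rightarrow> 'f) \<Rightarrow> ('x \<Rightarrow> 'f) \<Rightarrow> 'f::dedekind_complete_riesz_space" where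
  "uniform_metric X f g = (SUP x\<in>X. \<bar>f x - g x\<bar>)"

end

theory Submission
  imports Defs
begin

text \<open>
  Fix a base point \<open>z\<close> and a bound \<open>a\<close> of \<open>d\<close>. If \<open>S\<close> and \<open>T\<close> are positive operators dominating
  \<open>f\<close> and \<open>g\<close>, then \<open>\<bar>f x - g x\<bar> \<le> \<bar>f x - f z\<bar> + \<bar>f z - g z\<bar> + \<bar>g x - g z\<bar> \<le> S a + \<bar>f z - g z\<bar> + T a\<close>,
  so the suprema defining the uniform metric exist by Dedekind completeness.
\<close>

lemma positive_operator_mono:
  assumes "positive_operator T" and "x \<le> y"
  shows "T x \<le> T y"
proof -
  have "T (y - x) = T y - T x"
    using assms(1) by (simp add: positive_operator_def linear_diff)
  moreover have "T (y - x) \<ge> 0"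
    using assms by (simp add: positive_operator_def)
  ultimately show ?thesis by simp
qed

lemma positive_operator_zero: "positive_operator (\<lambda>_. 0)"
  by (simp add: positive_operator_def linear_zero)

lemma decreases_to_zero_const: "decreases_to_zero (\<lambda>_. 0)"
  by (auto simp: decreases_to_zero_def decseq_def isGlb_def greatestP_def isLb_def setge_def setle_def)

text \<open>Supplies the nonemptiness that a vector metric space requires. The zero operator
  dominates the zero function, and the constant sequence 0 witnesses convergence of its
  values.\<close>

lemma zero_in_C_vo: "restrict (\<lambda>_. 0) X \<in> C_vo X d"
proof -
  have "E_converges abs_metric (\<lambda>n. restrict (\<lambda>_. 0) X (xs n)) (restrict (\<lambda>_. 0) X x)"
    if "x \<in> X" "range xs \<subseteq> X" for x and xs :: "nat \<Rightarrow> 'a"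
    using that decreases_to_zero_const
    by (auto simp: E_converges_def abs_metric_def range_subsetD intro!: exI[of _ "\<lambda>_. 0"])
  then show ?thesis
    unfolding C_vo_def vectorial_continuous_def
    using positive_operator_zero by (auto intro!: exI[of _ "\<lambda>_. 0"])
qed

text \<open>A dominating positive operator \<open>T\<close> is monotone, so a bound \<open>a\<close>
  of the metric turns into the bound \<open>T a\<close> of the oscillation.\<close>

lemma C_vo_osc_bounded:
  assumes "E_bounded d X" and "f \<in> C_vo X d"
  obtains b where "\<And>x y. x \<in> X \<Longrightarrow> y \<in> X \<Longrightarrow> \<bar>f x - f y\<bar> \<le> b"
proof -
  obtain a where a: "\<And>x y. x \<in> X \<Longrightarrow> y \<in> X \<Longrightarrow> d x y \<le> a"
    using assms(1) by (auto simp: E_bounded_def)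
  obtain T where T: "positive_operator T" "\<And>x y. x \<in> X \<Longrightarrow> y \<in> X \<Longrightarrow> \<bar>f x - f y\<bar> \<le> T (d x y)"
    using assms(2) by (auto simp: C_vo_def)
  show thesis
    by (rule that[of "T a"]) (meson T a positive_operator_mono order_trans)
qed

lemma C_vo_diff_bdd_above:
  fixes f g :: "'x \<Rightarrow> 'f::riesz_space"
  assumes "E_bounded d X" "f \<in> C_vo X d" "g \<in> C_vo X d"
  obtains c where "\<And>x. x \<in> X \<Longrightarrow> \<bar>f x - g x\<bar> \<le> c"
\<comment> \<open>The estimate needs a base point; over an empty \<open>X\<close> any
  \<open>c\<close> is a bound.\<close>
proof (cases "X = {}")
  case True
  then show ?thesis using that by blast
next
  case False
  then obtain z where z: "z \<in> X" by blast
  obtain b where b: "\<And>x y. x \<in> X \<Longrightarrow> y \<in> X \<Longrightarrow> \<bar>f x - f y\<bar> \<le> b"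
    using C_vo_osc_bounded[OF assms(1,2)] by blast
  obtain b' where b': "\<And>x y. x \<in> X \<Longrightarrow> y \<in> X \<Longrightarrow> \<bar>g x - g y\<bar> \<le> b'"
    using C_vo_osc_bounded[OF assms(1,3)] by blast
  show ?thesis
  proof (rule that)
    fix x assume x: "x \<in> X"
    have "\<bar>f x - g x\<bar> = \<bar>(f x - f z) + (f z - g z) + (g z - g x)\<bar>"
      by simp
    also have "\<dots> \<le> \<bar>f x - f z\<bar> + \<bar>f z - g z\<bar> + \<bar>g z - g x\<bar>"
      by (meson abs_triangle_ineq add_right_mono order_trans)
    also have "\<dots> \<le> b + \<bar>f z - g z\<bar> + b'"
      using b[OF x z] b'[OF z x] by (intro add_mono) auto
    finally show "\<bar>f x - g x\<bar> \<le> b + \<bar>f z - g z\<bar> + b'" .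
  qed
qed

text \<open>\<open>SUP\<close> is specified only for nonempty sets that are bounded above. The two
  assumptions thus make the formula of \<open>uniform_metric\<close> a genuine least upper
  bound.\<close>

lemma isLub_uniform_metric:
  fixes f g :: "'x \<Rightarrow> 'f::dedekind_complete_riesz_space"
  assumes "X \<noteq> {}" and "bdd_above ((\<lambda>x. \<bar>f x - g x\<bar>) ` X)"
  shows "isLub UNIV ((\<lambda>x. \<bar>f x - g x\<bar>) ` X) (uniform_metric X f g)"
  using assms
  by (auto simp: uniform_metric_def isLub_def leastP_def isUb_def setge_def setle_def
      intro: cSUP_upper cSUP_least)

text \<open>Both axioms come pointwise from the absolute value: every
  \<open>\<bar>f x - g x\<bar>\<close> lies below its supremum, and the triangle inequality is
  applied at each point before the supremum is taken.\<close>

lemma vector_metric_space_uniform_metric: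
  fixes C :: "('x \<Rightarrow> 'f::dedekind_complete_riesz_space) set"
  assumes "X \<noteq> {}" "C \<noteq> {}" "C \<subseteq> extensional X"
    and bdd: "\<And>f g. f \<in> C \<Longrightarrow> g \<in> C \<Longrightarrow> bdd_above ((\<lambda>x. \<bar>f x - g x\<bar>) ` X)"
  shows "vector_metric_space C (uniform_metric X)"
proof
  have upper: "\<bar>f x - g x\<bar> \<le> uniform_metric X f g" if "f \<in> C" "g \<in> C" "x \<in> X" for f g x
    unfolding uniform_metric_def using that bdd by (intro cSUP_upper) auto
  show "C \<noteq> {}" by fact
  show "uniform_metric X f g = 0 \<longleftrightarrow> f = g" if fg: "f \<in> C" "g \<in> C" for f g
  proof
    assume eq: "uniform_metric X f g = 0"
    show "f = g"
    \<comment> \<open>A zero supremum forces agreement on \<open>X\<close> only; outside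
      \<open>X\<close> both functions are \<open>undefined\<close>.\<close>
    proof (rule extensionalityI[where A = X])
      fix x assume "x \<in> X"
      then have "\<bar>f x - g x\<bar> \<le> 0" using upper[OF fg] eq by metis
      then show "f x = g x" by simp
    qed (use fg assms(3) in auto)
  next
    assume "f = g"
    \<comment> \<open>The supremum is that of the constant 0 over the nonempty set
      \<open>X\<close>.\<close>
    then show "uniform_metric X f g = 0"
      using assms(1) by (simp add: uniform_metric_def)
  qed
  show "uniform_metric X f g \<le> uniform_metric X f h + uniform_metric X g h"
    if C: "f \<in> C" "g \<in> C" "h \<in> C" for f g h
    unfolding uniform_metric_def[of X f g]
  proof (rule cSUP_least)
    fix x assume x: "x \<in> X"
    \<comment> \<open>Written as a difference so that \<open>h\<close> comes second in both terms,
      as \<open>vm2\<close> demands.\<close>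
    have "\<bar>f x - g x\<bar> = \<bar>(f x - h x) - (g x - h x)\<bar>" by simp
    also have "\<dots> \<le> \<bar>f x - h x\<bar> + \<bar>g x - h x\<bar>" by (rule abs_triangle_ineq4)
    also have "\<dots> \<le> uniform_metric X f h + uniform_metric X g h"
      using C x by (intro add_mono upper)
    finally show "\<bar>f x - g x\<bar> \<le> uniform_metric X f h + uniform_metric X g h" .
  qed fact
qed


theorem corollary5:
  fixes X :: "'x set" and d :: "'x \<Rightarrow> 'x \<Rightarrow> 'e::riesz_space"
  assumes "vector_metric_space X d" and "E_bounded d X"
  defines "C \<equiv> (C_vo X d :: ('x \<Rightarrow> 'f::dedekind_complete_riesz_space) set)"
  shows "(\<forall>f\<in>C. \<forall>g\<in>C. isLub UNIV ((\<lambda>x. \<bar>f x - g x\<bar>) ` X) (uniform_metric X f g)) \<and>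
         vector_metric_space C (uniform_metric X)"
proof -
  have X: "X \<noteq> {}"
    using assms(1) by (rule vector_metric_space.nonempty)
  have bdd: "bdd_above ((\<lambda>x. \<bar>f x - g x\<bar>) ` X)" if fg: "f \<in> C" "g \<in> C" for f g
  proof -
    obtain c where "\<And>x. x \<in> X \<Longrightarrow> \<bar>f x - g x\<bar> \<le> c"
      using C_vo_diff_bdd_above[OF assms(2) fg[unfolded C_def]] by blast
    then show ?thesis by (rule bdd_aboveI2)
  qed
  have "C \<noteq> {}" "C \<subseteq> extensional X"
    using zero_in_C_vo unfolding C_def by (blast, auto simp: C_vo_def)
  then show ?thesis
    using X bdd by (simp add: isLub_uniform_metric vector_metric_space_uniform_metric)
qed

end
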